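(* Consider the infinite color urn model with colors indexed by $\mathbb{Z}$ (the case $d=1$) associated with the bounded increment random walk with increments $\{X_j\}_{j\ge1}$, and let $Z_n$ be the color of the $(n+1)$-th selected ball. Let $a\in\mathbb{R}$ and let $h>0$ be the span of $X_1$, i.e. $\mathbb{P}(X_1\in a+h\mathbb{Z})=1$ and $h$ is the maximum value for which this holds. For $n\ge2$ define $$\mathcal{L}_n^{(1)}:=\left\{x: x=\frac{n}{\sigma\sqrt{\log n}}a-\frac{\mu}{\sigma}\sqrt{\log n}+\frac{h}{\sigma\sqrt{\log n}}z,\ z\in\mathbb{Z}\right\}.$$ Assume that $\mathbb{P}[X_1=0]>0$. Then, as $n\to\infty$, $$\sup_{x\in\mathcal{L}_n^{(1)}}\left|\sigma\frac{\sqrt{\log n}}{h}\,\mathbb{P}\left(\frac{Z_n-\mu\log n}{\sigma\sqrt{\log n}}=x\right)-\phi(x)\right|\longrightarrow 0.$$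
   Context: $\{X_j\}_{j\ge1}$ are i.i.d. random variables in $\mathbb{Z}$ with probability mass function $p(u)=\mathbb{P}(X_1=u)$, and there is a finite non-empty $B\subseteq\mathbb{Z}$ with $p(u)=0$ for $u\notin B$. Put $\mu:=\mathbb{E}[X_1]$ and $\sigma^2:=\mathbb{E}[X_1^2]$ (non-centered second moment), with $\sigma>0$. Urn model: let $R=((p(v-u)))_{u,v\in\mathbb{Z}}$ and let $R_u$ be the $u$-th row of $R$. The initial configuration $U_0=(U_{0,v})_{v\in\mathbb{Z}}$ is a (non-random) probability vector with $U_{0,v}=0$ for all but finitely many $v\in\mathbb{Z}$. For $n\ge0$, the color $Z_n\in\mathbb{Z}$ of the $(n+1)$-th selected ball satisfies $\mathbb{P}(Z_n=v\mid U_n,\dots,U_0)=U_{n,v}/(n+1)$, $v\in\mathbb{Z}$, and $U_{n+1}=U_n+R_{Z_n}$, i.e. $U_{n+1,v}=U_{n,v}+p(v-Z_n)$. (So $\sum_v U_{n,v}=n+1$.) $\phi(x)=\frac{1}{\sqrt{2\pi}}e^{-x^2/2}$ is the standard Gaussian density.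
   Formalization: The formal theorem also assumes that every color v with U_{0,v} ≠ 0 is a multiple of the span h; otherwise the claim fails, e.g. U_0 concentrated at color 1 and p(0)=p(2)=1/2, where Z_n is always odd but the lattice corresponds to even colors. *)

theory Defs
  imports "HOL-Probability.Probability"
begin

definition iid_int :: "'a measure \<Rightarrow> (nat \<Rightarrow> 'a \<Rightarrow> int) \<Rightarrow> bool" where
  "iid_int N X \<longleftrightarrow>
     prob_space.indep_vars N (\<lambda>_. count_space UNIV) X {1..} \<and>
     (\<forall>j\<ge>1. distr N (count_space UNIV) (X j) = distr N (count_space UNIV) (X 1))"

definition pmf_at :: "'a measure \<Rightarrow> ('a \<Rightarrow> int) \<Rightarrow> int \<Rightarrow> real" where
  "pmf_at N Y u = measure N {\<omega> \<in> space N. Y \<omega> = u}"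

definition shifted_lattice :: "real \<Rightarrow> real \<Rightarrow> real set" where
  "shifted_lattice a h = {x. \<exists>z::int. x = a + h * real_of_int z}"

text \<open>
  The maximality of the step \<open>h\<close> is over all shifts, as usual for the span of a lattice
  distribution. For a fixed shift one would get something else: a variable with values
  \<open>0\<close> and \<open>2\<close> has span \<open>2\<close>, but \<open>1\<close> is the largest step that works with shift \<open>1\<close>.
\<close>

definition is_span :: "'a measure \<Rightarrow> ('a \<Rightarrow> int) \<Rightarrow> real \<Rightarrow> bool" where
  "is_span N Y h \<longleftrightarrow> h > 0 \<and>
     (\<exists>a. measure N {\<omega> \<in> space N. real_of_int (Y \<omega>) \<in> shifted_lattice a h} = 1) \<and>
     (\<forall>a' h'. h' > 0 \<longrightarrow>
        measure N {\<omega> \<in> space N. real_of_int (Y \<omega>) \<in> shifted_lattice a' h'} = 1 \<longrightarrow> h' \<le> h)"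

definition replacement :: "(int \<Rightarrow> real) \<Rightarrow> int \<Rightarrow> int \<Rightarrow> real" where
  "replacement p u v = p (v - u)"

text \<open>The sigma-algebra generated by the configurations \<open>U 0, \<dots>, U n\<close>.\<close>

definition urn_history ::
    "'w measure \<Rightarrow> (nat \<Rightarrow> 'w \<Rightarrow> int \<Rightarrow> real) \<Rightarrow> nat \<Rightarrow> 'w measure" where
  "urn_history M U n = sigma (space M)
     (\<Union>k\<le>n. \<Union>v. {(\<lambda>\<omega>. U k \<omega> v) -` A \<inter> space M | A. A \<in> sets borel})"

definition initial_configuration :: "(int \<Rightarrow> real) \<Rightarrow> bool" where
  "initial_configuration U0 \<longleftrightarrow>
     (\<forall>v. U0 v \<ge> 0) \<and> finite {v. U0 v \<noteq> 0} \<and> (\<Sum>v | U0 v \<noteq> 0. U0 v) = 1"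

text \<open>
  \<open>U n \<omega> v\<close> is the content of colour \<open>v\<close> after \<open>n\<close> draws and \<open>Z n\<close> is the colour
  of the ball selected in draw \<open>n + 1\<close>. Measurability of the configurations follows from that
  of the selected colours.
\<close>

definition infinite_color_urn ::
    "'w measure \<Rightarrow> (int \<Rightarrow> real) \<Rightarrow> (int \<Rightarrow> real) \<Rightarrow>
     (nat \<Rightarrow> 'w \<Rightarrow> int \<Rightarrow> real) \<Rightarrow> (nat \<Rightarrow> 'w \<Rightarrow> int) \<Rightarrow> bool" where
  "infinite_color_urn M p U0 U Z \<longleftrightarrow>
     prob_space M \<and>
     (\<forall>n. Z n \<in> measurable M (count_space UNIV)) \<and>
     (\<forall>\<omega>\<in>space M. U 0 \<omega> = U0) \<and>
     (\<forall>n. \<forall>\<omega>\<in>space M. \<forall>v. U (Suc n) \<omega> v = U n \<omega> v + replacement p (Z n \<omega>) v) \<and>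
     (\<forall>n v. AE \<omega> in M.
        real_cond_exp M (urn_history M U n) (indicator {\<omega>' \<in> space M. Z n \<omega>' = v}) \<omega>
          = U n \<omega> v / real (n + 1))"

text \<open>
  The rescaled image of the lattice \<open>n * a + h * \<int>\<close>. If the variable with span \<open>h\<close> charges
  \<open>0\<close>, then \<open>a\<close> is a multiple of \<open>h\<close> and this lattice is \<open>h * \<int>\<close>; the local limit
  theorem on it needs the initial colours to be multiples of \<open>h\<close> too. (With \<open>U 0\<close>
  concentrated on colour \<open>1\<close> and increments \<open>0\<close>, \<open>2\<close>, every selected colour is odd, so all
  probabilities on the lattice vanish.)
\<close>

definition urn_lattice :: "real \<Rightarrow> real \<Rightarrow> real \<Rightarrow> real \<Rightarrow> nat \<Rightarrow> real set" where
  "urn_lattice a h \<mu> \<sigma> n = {x. \<exists>z::int.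
     x = real n / (\<sigma> * sqrt (ln (real n))) * a - \<mu> / \<sigma> * sqrt (ln (real n))
         + h / (\<sigma> * sqrt (ln (real n))) * real_of_int z}"

end

theory Submission
  imports Defs
begin

text \<open>
  Let \<open>e\<close> be the characteristic function of the increment. The law of \<open>Z n\<close> is the mean configuration
  divided by \<open>n + 1\<close>, and the replacement rule turns this into a recursion for the laws
  (\<open>urn_colour_law\<close>), which in terms of characteristic functions reads
  \<open>\<Phi> (n + 1) = \<Phi> n * (n + 1 + e) / (n + 2)\<close>. Thus \<open>Z n\<close> has the law of the initial colour plus the sum
  over \<open>j = 1, \<dots>, n\<close> of independent steps that are taken with probability \<open>1 / (j + 1)\<close>: a random
  walk that makes about \<open>ln n\<close> steps. In Fourier terms, \<open>\<Phi> n\<close> is the transform of the initial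
  configuration times \<open>lazy_product e n\<close>, which behaves like \<open>exp ((e - 1) ln n)\<close>.

  The local limit theorem follows by the classical Fourier argument. On the lattice \<open>h \<int>\<close> the
  probabilities are integrals of \<open>\<Phi> n\<close> over \<open>[- pi / h, pi / h]\<close> (\<open>urn_fourier_inversion\<close>). After
  rescaling the variable by \<open>\<sigma> sqrt (ln n)\<close>, the integrand, once centred, converges to
  \<open>exp (- s\<^sup>2 / 2)\<close> (\<open>urn_cf_tendsto\<close>). It is dominated by a Gaussian because
  \<open>\<bar>lazy_product e n\<bar>\<close> is at most a constant times \<open>exp (- (1 - Re e) ln n)\<close>
  (\<open>norm_lazy_product_le\<close>) and \<open>1 - Re (e t) \<ge> \<kappa> t\<^sup>2\<close> on the whole interval of integration
  (\<open>one_minus_Re_mass_cf_ge\<close>). The maximality of the span \<open>h\<close> enters in this last bound, by excluding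
  further frequencies with \<open>e t = 1\<close>. Dominated convergence gives convergence in \<open>L\<^sup>1\<close>
  (\<open>urn_cf_L1_convergence\<close>), hence convergence of the probabilities uniformly over the lattice
  (\<open>urn_local_limit\<close>).

  Two arithmetic facts connect this with the rescaled lattice of the statement. The increment charges
  \<open>0\<close>, so the shift \<open>a\<close> is a multiple of \<open>h\<close> and \<open>n a + h \<int>\<close> is \<open>h \<int>\<close>. And \<open>h\<close> is the greatest common
  divisor of the support (\<open>maximal_step_eq_Gcd\<close>), so that every point of \<open>h \<int>\<close> is a colour.
\<close>

section \<open>The product of lazy factors\<close>

text \<open>
  With \<open>e\<close> the characteristic function of \<open>X\<close> at \<open>t\<close>, the factor \<open>(j + e) / (j + 1)\<close> is the
  characteristic function at \<open>t\<close> of a step that equals \<open>X\<close> with probability \<open>1 / (j + 1)\<close> and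
  \<open>0\<close> otherwise. As a function of \<open>n\<close> the product grows like \<open>n powr (e - 1)\<close>, up to a Gamma factor
  that tends to \<open>1\<close> as \<open>e\<close> tends to \<open>1\<close>; the two estimates below make this quantitative.
\<close>

definition lazy_product :: "complex \<Rightarrow> nat \<Rightarrow> complex" where
  "lazy_product e n = (\<Prod>j=1..n. (of_nat j + e) / of_nat (Suc j))"

lemma lazy_product_0: "lazy_product e 0 = 1"
  by (simp add: lazy_product_def)

lemma lazy_product_Suc:
  "lazy_product e (Suc n) = lazy_product e n * ((of_nat (Suc n) + e) / of_nat (Suc (Suc n)))"
  by (simp add: lazy_product_def)

lemma continuous_lazy_product [continuous_intros]:
  "continuous_on A f \<Longrightarrow> continuous_on A (\<lambda>t. lazy_product (f t) n)"
  unfolding lazy_product_def by (intro continuous_intros ballI of_nat_neq_0)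

lemma sum_inverse_near_ln:
  assumes "n \<ge> 1"
  shows "\<bar>(\<Sum>j=1..n. 1 / real (Suc j)) - ln (real n)\<bar> \<le> 1"
proof -
  have eq: "(\<Sum>j=1..m. 1 / real (Suc j)) = harm (Suc m) - 1" for m
    by (induction m) (simp_all add: harm_Suc harm_expand inverse_eq_divide)
  have "harm (Suc n) - ln (real (Suc n)) \<le> 1"
    using euler_mascheroni_sequence_decreasing[of 1 "Suc n"] by (simp add: harm_expand)
  moreover have "ln (real (Suc n)) \<le> ln (real n) + 1"
  proof -
    have "ln (real n + 1) - ln (real n) < 1 / real n"
      using ln_diff_le_inverse[of "real n"] assms by simp
    also have "\<dots> \<le> 1" using assms by simp
    finally show ?thesis by (simp add: add.commute)
  qed
  moreover have "ln (real n) \<le> harm (Suc n)"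
  proof -
    have "ln (real n) \<le> ln (real (Suc n) + 1)" using assms by (subst ln_le_cancel_iff) auto
    then show ?thesis using ln_le_harm[of "Suc n"] by linarith
  qed
  ultimately show ?thesis unfolding eq by linarith
qed

lemma sum_inverse_squares_le:
  "(\<Sum>j=1..n. 1 / (real (Suc j))\<^sup>2) \<le> 1 - 1 / real (Suc n)"
proof (induction n)
  case (Suc n)
  have "1 / (real (Suc (Suc n)))\<^sup>2 \<le> 1 / real (Suc n) - 1 / real (Suc (Suc n))"
    by (simp add: divide_simps power2_eq_square)
  then show ?case using Suc by simp
qed simp

text \<open>
  Expanding the square gives \<open>\<bar>j + e\<bar>\<^sup>2 \<le> (j + 1)\<^sup>2 - 2 j (1 - Re e)\<close> on the unit disc, so the saving
  in each factor is governed by \<open>1 - Re e\<close> alone.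
\<close>

lemma norm_lazy_factor_le_exp:
  assumes "cmod e \<le> 1" "j \<ge> 1"
  shows "cmod ((of_nat j + e) / of_nat (Suc j)) \<le> exp (- ((1 - Re e) * real j / (real (Suc j))\<^sup>2))"
proof -
  define y where "y = (1 - Re e) * real j / (real (Suc j))\<^sup>2"
  have "(cmod (of_nat j + e))\<^sup>2 = (real j + Re e)\<^sup>2 + (Im e)\<^sup>2"
    by (simp add: cmod_power2)
  also have "\<dots> = (real j)\<^sup>2 + 2 * real j * Re e + (cmod e)\<^sup>2"
    by (simp add: cmod_power2 power2_sum)
  also have "\<dots> \<le> (real j)\<^sup>2 + 2 * real j * Re e + 1"
    using assms(1) by (simp add: power_le_one)
  also have "\<dots> = (real (Suc j))\<^sup>2 - 2 * real j * (1 - Re e)"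
    by (simp add: algebra_simps power2_eq_square)
  finally have "(cmod (of_nat j + e))\<^sup>2 / (real (Suc j))\<^sup>2
      \<le> ((real (Suc j))\<^sup>2 - 2 * real j * (1 - Re e)) / (real (Suc j))\<^sup>2"
    by (intro divide_right_mono) auto
  also have "\<dots> = 1 - 2 * y"
    by (simp add: y_def diff_divide_distrib mult_ac)
  also have "\<dots> \<le> exp (- 2 * y)"
    using exp_ge_add_one_self[of "- 2 * y"] by simp
  also have "\<dots> = (exp (- y))\<^sup>2"
    by (simp add: power2_eq_square flip: exp_add)
  finally have "(cmod ((of_nat j + e) / of_nat (Suc j)))\<^sup>2 \<le> (exp (- y))\<^sup>2"
    by (simp add: norm_divide power_divide del: of_nat_Suc)
  then show ?thesis unfolding y_def[symmetric]
    by (rule power2_le_imp_le) simp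
qed

lemma norm_lazy_factor_le_1:
  assumes "cmod e \<le> 1"
  shows "cmod ((of_nat j + e) / of_nat (Suc j)) \<le> 1"
proof -
  have "cmod (of_nat j + e) \<le> real (Suc j)"
    using norm_triangle_ineq[of "of_nat j" e] assms by simp
  then show ?thesis by (simp add: norm_divide del: of_nat_Suc)
qed

text \<open>
  The savings \<open>j / (j + 1)\<^sup>2 = 1 / (j + 1) - 1 / (j + 1)\<^sup>2\<close> sum to at least \<open>ln n - 2\<close>, and
  \<open>1 - Re e \<le> 2\<close> turns the deficit \<open>2\<close> into the constant factor \<open>exp 4\<close>. This bound supplies the
  Gaussian majorant for dominated convergence.
\<close>

lemma norm_lazy_product_le:
  assumes e: "cmod e \<le> 1" and n: "n \<ge> 1"
  shows "cmod (lazy_product e n) \<le> exp 4 * exp (- ((1 - Re e) * ln (real n)))"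
proof -
  have c: "0 \<le> 1 - Re e" "1 - Re e \<le> 2"
    using abs_Re_le_cmod[of e] e by linarith+
  define s where "s = (\<Sum>j=1..n. real j / (real (Suc j))\<^sup>2)"
  have "s = (\<Sum>j=1..n. 1 / real (Suc j) - 1 / (real (Suc j))\<^sup>2)"
    unfolding s_def by (intro sum.cong) (auto simp: divide_simps power2_eq_square)
  also have "\<dots> \<ge> ln (real n) - 2"
    using sum_inverse_near_ln[OF n] sum_inverse_squares_le[of n]
      divide_nonneg_nonneg[of 1 "real (Suc n)"]
    unfolding sum_subtractf by linarith
  finally have s: "ln (real n) - 2 \<le> s" .
  have "cmod (lazy_product e n) \<le> (\<Prod>j=1..n. exp (- ((1 - Re e) * real j / (real (Suc j))\<^sup>2)))"
    unfolding lazy_product_def prod_norm[symmetric]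
    by (intro prod_mono) (use norm_lazy_factor_le_exp[OF e] in auto)
  also have "\<dots> = exp (- ((1 - Re e) * s))"
    by (simp add: s_def sum_distrib_left sum_negf flip: exp_sum)
  also have "\<dots> \<le> exp (4 - (1 - Re e) * ln (real n))"
  proof -
    have "(1 - Re e) * (ln (real n) - 2) \<le> (1 - Re e) * s"
      using s c by (intro mult_left_mono) auto
    then show ?thesis using c by (simp add: algebra_simps)
  qed
  finally show ?thesis by (simp add: exp_diff exp_minus divide_inverse)
qed

text \<open>
  Replacing each factor \<open>1 + w / (j + 1)\<close>, where \<open>w = e - 1\<close>, by \<open>exp (w / (j + 1))\<close> costs only a
  second order term, and these are summable in \<open>j\<close>. All numbers involved have modulus at most \<open>1\<close>
  (here \<open>Re w \<le> 0\<close> enters), so the errors in the factors add up and do not multiply. Replacing then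
  the harmonic sum in the exponent by \<open>ln n\<close> costs another multiple of \<open>\<bar>w\<bar>\<close>.
\<close>

lemma lazy_product_near_power:
  assumes e: "cmod e \<le> 1" and n: "n \<ge> 1"
  shows "cmod (lazy_product e n - exp ((e - 1) * ln (real n))) \<le> 3 * exp 2 * cmod (e - 1)"
proof -
  define w where "w = e - 1"
  have w: "cmod w \<le> 2" "Re w \<le> 0"
    using e norm_triangle_ineq4[of e 1] abs_Re_le_cmod[of e] by (auto simp: w_def)
  have absRe: "\<bar>Re z\<bar> \<le> 2" if "cmod z \<le> 2" for z
    using abs_Re_le_cmod[of z] that by linarith
  define s where "s = (\<Sum>j=1..n. 1 / real (Suc j))"
  define \<delta> where "\<delta> = s - ln (real n)"
  have \<delta>: "\<bar>\<delta>\<bar> \<le> 1" using sum_inverse_near_ln[OF n] by (simp add: \<delta>_def s_def)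
  have L: "ln (real n) \<ge> 0" using n by simp
  have "cmod (lazy_product e n - (\<Prod>j=1..n. exp (w / of_nat (Suc j))))
      \<le> (\<Sum>j=1..n. cmod ((of_nat j + e) / of_nat (Suc j) - exp (w / of_nat (Suc j))))"
    unfolding lazy_product_def
  proof (rule norm_prod_diff)
    show "cmod ((of_nat j + e) / of_nat (Suc j)) \<le> 1" for j
      using norm_lazy_factor_le_1[OF e] .
    show "cmod (exp (w / of_nat (Suc j))) \<le> 1" for j
    proof -
      have "Re (w / of_nat (Suc j)) = Re w / real (Suc j)"
        by (metis Re_divide_of_real of_real_of_nat_eq)
      also have "\<dots> \<le> 0" using w by (simp add: divide_nonpos_pos)
      finally show ?thesis by simp
    qed
  qed
  also have "\<dots> \<le> (\<Sum>j=1..n. exp 2 * cmod w * (2 / (real (Suc j))\<^sup>2))"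
  proof (rule sum_mono)
    fix j assume "j \<in> {1..n}"
    define z where "z = w / of_nat (Suc j)"
    have z: "cmod z = cmod w / real (Suc j)" by (simp add: z_def norm_divide del: of_nat_Suc)
    have "cmod z \<le> cmod w / 1" unfolding z by (intro divide_left_mono) auto
    then have ez: "exp \<bar>Re z\<bar> \<le> exp 2" using w absRe[of z] by simp
    have "(of_nat j + e) / of_nat (Suc j) = 1 + z"
    proof -
      have "of_nat j + e = of_nat (Suc j) + w" by (simp add: w_def)
      moreover have "complex_of_nat (Suc j) \<noteq> 0" by (rule of_nat_neq_0)
      ultimately show ?thesis by (simp only: z_def add_divide_distrib divide_self_if if_False)
    qed
    then have "cmod ((of_nat j + e) / of_nat (Suc j) - exp z) = cmod (exp z - (\<Sum>k\<le>1. z ^ k / fact k))"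
      by (simp add: norm_minus_commute)
    also have "\<dots> \<le> exp \<bar>Re z\<bar> * (cmod z)\<^sup>2"
      using Taylor_exp[of z 1] by (simp add: numeral_2_eq_2)
    also have "\<dots> \<le> exp 2 * (cmod z)\<^sup>2" using ez by (intro mult_right_mono) auto
    also have "\<dots> = exp 2 * (cmod w * cmod w / (real (Suc j))\<^sup>2)"
      by (simp add: z power2_eq_square)
    also have "\<dots> \<le> exp 2 * (cmod w * 2 / (real (Suc j))\<^sup>2)"
      using w by (intro mult_left_mono divide_right_mono) auto
    finally show "cmod ((of_nat j + e) / of_nat (Suc j) - exp (w / of_nat (Suc j)))
        \<le> exp 2 * cmod w * (2 / (real (Suc j))\<^sup>2)" by (simp add: z_def)
  qed
  also have "\<dots> = 2 * exp 2 * cmod w * (\<Sum>j=1..n. 1 / (real (Suc j))\<^sup>2)"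
    by (simp add: sum_distrib_left mult_ac)
  also have "\<dots> \<le> 2 * exp 2 * cmod w * 1"
    using order_trans[OF sum_inverse_squares_le[of n], of 1] by (intro mult_left_mono) auto
  finally have 1: "cmod (lazy_product e n - (\<Prod>j=1..n. exp (w / of_nat (Suc j)))) \<le> 2 * exp 2 * cmod w"
    by simp
  have "(\<Prod>j=1..n. exp (w / of_nat (Suc j))) = exp (w * of_real s)"
  proof -
    have "(\<Prod>j=1..n. exp (w / of_nat (Suc j))) = exp (\<Sum>j=1..n. w / of_nat (Suc j))"
      by (rule exp_sum[symmetric]) simp
    also have "(\<Sum>j=1..n. w / of_nat (Suc j)) = w * of_real s"
      unfolding s_def of_real_sum sum_distrib_left by (intro sum.cong) simp_all
    finally show ?thesis .
  qed
  also have "w * of_real s = w * ln (real n) + w * \<delta>"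
    by (simp add: \<delta>_def algebra_simps)
  finally have "(\<Prod>j=1..n. exp (w / of_nat (Suc j))) - exp (w * ln (real n))
      = exp (w * ln (real n)) * (exp (w * \<delta>) - 1)"
    by (simp add: exp_add algebra_simps)
  then have "cmod ((\<Prod>j=1..n. exp (w / of_nat (Suc j))) - exp (w * ln (real n)))
      = exp (Re w * ln (real n)) * cmod (exp (w * \<delta>) - 1)"
    by (simp add: norm_mult)
  also have "\<dots> \<le> 1 * (exp 2 * cmod w)"
  proof (rule mult_mono)
    show "exp (Re w * ln (real n)) \<le> 1" using w L by (simp add: mult_nonpos_nonneg)
    have le: "cmod (w * \<delta>) \<le> cmod w"
      using mult_left_mono[OF \<delta>, of "cmod w"] by (simp add: norm_mult)
    have "cmod (exp (w * \<delta>) - 1) \<le> exp \<bar>Re (w * \<delta>)\<bar> * cmod (w * \<delta>)"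
      using Taylor_exp[of "w * \<delta>" 0] by simp
    also have "\<dots> \<le> exp 2 * cmod w"
    proof (rule mult_mono)
      show "exp \<bar>Re (w * \<delta>)\<bar> \<le> exp 2"
        using absRe[OF order_trans[OF le w(1)]] by (simp only: exp_le_cancel_iff)
    qed (use le in auto)
    finally show "cmod (exp (w * \<delta>) - 1) \<le> exp 2 * cmod w" .
  qed auto
  finally show ?thesis
    using 1 norm_triangle_ineq[of "lazy_product e n - (\<Prod>j=1..n. exp (w / of_nat (Suc j)))"
        "(\<Prod>j=1..n. exp (w / of_nat (Suc j))) - exp (w * ln (real n))"]
    by (simp add: w_def)
qed

section \<open>Characteristic functions of finitely supported laws\<close>

definition mass_cf :: "(int \<Rightarrow> real) \<Rightarrow> int set \<Rightarrow> real \<Rightarrow> complex" where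
  "mass_cf p B t = (\<Sum>u\<in>B. p u * iexp (t * real_of_int u))"

lemma continuous_mass_cf [continuous_intros]:
  "continuous_on A f \<Longrightarrow> continuous_on A (\<lambda>t. mass_cf p B (f t))"
  unfolding mass_cf_def by (intro continuous_intros)

lemma mass_cf_0: "sum p B = 1 \<Longrightarrow> mass_cf p B 0 = 1"
  by (simp add: mass_cf_def flip: of_real_sum)

lemma norm_mass_cf_le_1:
  assumes "\<And>u. p u \<ge> 0" "sum p B = 1"
  shows "cmod (mass_cf p B t) \<le> 1"
proof -
  have "cmod (mass_cf p B t) \<le> (\<Sum>u\<in>B. cmod (p u * iexp (t * u)))"
    unfolding mass_cf_def by (rule norm_sum)
  also have "\<dots> = sum p B"
    using assms by (intro sum.cong) (auto simp: norm_mult)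
  finally show ?thesis using assms by simp
qed

lemma mass_cf_expansion:
  assumes "\<And>u. p u \<ge> 0" "sum p B = 1"
  shows "cmod (mass_cf p B t
      - (1 + \<i> * of_real (t * (\<Sum>u\<in>B. p u * u)) - of_real (t\<^sup>2 * (\<Sum>u\<in>B. p u * u\<^sup>2) / 2)))
    \<le> \<bar>t\<bar>^3 * (\<Sum>u\<in>B. p u * \<bar>real_of_int u\<bar>^3)"
proof -
  define r where "r u = iexp (t * u) - (1 + \<i> * of_real (t * real_of_int u) - of_real ((t * real_of_int u)\<^sup>2 / 2))" for u
  have r: "cmod (r u) \<le> \<bar>t\<bar>^3 * \<bar>real_of_int u\<bar>^3" for u
  proof -
    have "cmod (r u) \<le> \<bar>t * u\<bar>^3 / fact 3"
      using iexp_approx1[of "t * u" 2]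
      by (simp add: r_def eval_nat_numeral power_mult_distrib algebra_simps)
    also have "\<dots> \<le> \<bar>t * u\<bar>^3 / 1"
      by (intro divide_left_mono) (auto simp: fact_numeral)
    finally show ?thesis by (simp add: abs_mult power_mult_distrib)
  qed
  have "(\<Sum>u\<in>B. p u * r u) = mass_cf p B t
      - (of_real (sum p B) + \<i> * of_real (t * (\<Sum>u\<in>B. p u * u)) - of_real (t\<^sup>2 * (\<Sum>u\<in>B. p u * u\<^sup>2) / 2))"
    by (simp add: r_def mass_cf_def algebra_simps sum.distrib sum_subtractf sum_distrib_left
        sum_divide_distrib power_mult_distrib)
  then have "cmod (mass_cf p B t
      - (1 + \<i> * of_real (t * (\<Sum>u\<in>B. p u * u)) - of_real (t\<^sup>2 * (\<Sum>u\<in>B. p u * u\<^sup>2) / 2)))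
      = cmod (\<Sum>u\<in>B. p u * r u)"
    using assms(2) by simp
  also have "\<dots> \<le> (\<Sum>u\<in>B. cmod (p u * r u))" by (rule norm_sum)
  also have "\<dots> \<le> (\<Sum>u\<in>B. p u * (\<bar>t\<bar>^3 * \<bar>real_of_int u\<bar>^3))"
    by (intro sum_mono) (use assms r in \<open>auto simp: norm_mult intro!: mult_left_mono\<close>)
  also have "\<dots> = \<bar>t\<bar>^3 * (\<Sum>u\<in>B. p u * \<bar>real_of_int u\<bar>^3)"
    by (simp add: sum_distrib_left mult_ac)
  finally show ?thesis .
qed

text \<open>
  Since \<open>1 - cos y = y\<^sup>2 / 2 * (sinc (y / 2))\<^sup>2\<close>, the quotient of \<open>1 - Re (mass_cf p B t)\<close> by
  \<open>t\<^sup>2\<close> extends continuously to \<open>t = 0\<close>, and on the compact interval it attains its minimum. If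
  the minimum were \<open>0\<close>, attained at \<open>t \<noteq> 0\<close>, all points of the support would be multiples of
  \<open>2 pi / \<bar>t\<bar> \<ge> 2 h\<close>, against the maximality of \<open>h\<close>. At \<open>t = 0\<close> the value is half the second
  moment, which the point \<open>u0\<close> makes positive.
\<close>

lemma one_minus_Re_mass_cf_ge:
  fixes h :: real
  assumes p: "finite B" "\<And>u. p u \<ge> 0" "sum p B = 1" and "h > 0"
    and nondeg: "u0 \<in> B" "u0 \<noteq> 0" "p u0 > 0"
    and maximal: "\<And>d. d > 0 \<Longrightarrow> (\<And>u. u \<in> B \<Longrightarrow> p u > 0 \<Longrightarrow> real_of_int u \<in> shifted_lattice 0 d) \<Longrightarrow> d \<le> h"
  obtains \<kappa> where "\<kappa> > 0" "\<And>t. \<bar>t\<bar> \<le> pi / h \<Longrightarrow> \<kappa> * t\<^sup>2 \<le> 1 - Re (mass_cf p B t)"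
proof -
  \<comment> \<open>The quotient of the gap by the square of the argument, continued to 0.\<close>
  define g where "g t = (\<Sum>u\<in>B. p u * ((real_of_int u)\<^sup>2 / 2) * (sinc (t * u / 2))\<^sup>2)" for t :: real
  have gap: "1 - Re (mass_cf p B t) = t\<^sup>2 * g t" for t
  proof -
    have "1 - Re (mass_cf p B t) = sum p B - (\<Sum>u\<in>B. p u * cos (t * u))"
      using p by (simp add: mass_cf_def Re_exp)
    also have "\<dots> = (\<Sum>u\<in>B. p u * (1 - cos (t * u)))"
      by (simp add: sum_subtractf algebra_simps)
    also have "\<dots> = (\<Sum>u\<in>B. t\<^sup>2 * (p u * ((real_of_int u)\<^sup>2 / 2) * (sinc (t * u / 2))\<^sup>2))"
    proof (rule sum.cong)
      fix u assume "u \<in> B"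
      have "1 - cos (t * u) = 2 * (sin (t * u / 2))\<^sup>2"
        using cos_double_sin[of "t * u / 2"] by simp
      also have "\<dots> = t\<^sup>2 * ((real_of_int u)\<^sup>2 / 2) * (sinc (t * u / 2))\<^sup>2"
        by (auto simp: power2_eq_square)
      finally show "p u * (1 - cos (t * u)) = t\<^sup>2 * (p u * ((real_of_int u)\<^sup>2 / 2) * (sinc (t * u / 2))\<^sup>2)"
        by simp
    qed simp
    finally show ?thesis by (simp add: g_def sum_distrib_left)
  qed
  have g_nonneg: "g t \<ge> 0" for t
    unfolding g_def using p by (intro sum_nonneg) auto
  have g_pos: "g t > 0" if t: "\<bar>t\<bar> \<le> pi / h" for t
  proof (rule ccontr)
    assume "\<not> g t > 0"
    then have "g t = 0" using g_nonneg[of t] by linarith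
    then have zero: "p u * ((real_of_int u)\<^sup>2 / 2) * (sinc (t * u / 2))\<^sup>2 = 0" if "u \<in> B" for u
      unfolding g_def using p that by (subst (asm) sum_nonneg_eq_0_iff) auto
    have "t \<noteq> 0" using zero[OF nondeg(1)] nondeg by auto
    have "2 * pi / \<bar>t\<bar> \<le> h"
    proof (rule maximal)
      show "2 * pi / \<bar>t\<bar> > 0" using \<open>t \<noteq> 0\<close> by simp
      fix u assume u: "u \<in> B" "p u > 0"
      have "sin (t * u / 2) = 0" using zero[OF u(1)] u \<open>t \<noteq> 0\<close> by (auto split: if_splits)
      then obtain k :: int where "t * u / 2 = of_int k * pi"
        unfolding sin_zero_iff_int2 by auto
      then have "real_of_int u = 2 * pi / t * of_int k" using \<open>t \<noteq> 0\<close> by (simp add: field_simps)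
      \<comment> \<open>Only the modulus of the step matters: the sign of t moves to the integer factor.\<close>
      then have "real_of_int u = 0 + 2 * pi / \<bar>t\<bar> * of_int (if t > 0 then k else - k)"
        using \<open>t \<noteq> 0\<close> by (simp add: abs_if)
      then show "real_of_int u \<in> shifted_lattice 0 (2 * pi / \<bar>t\<bar>)"
        unfolding shifted_lattice_def by blast
    qed
    then have "2 * pi \<le> h * \<bar>t\<bar>" using \<open>t \<noteq> 0\<close> by (simp add: field_simps)
    moreover have "h * \<bar>t\<bar> \<le> pi" using t \<open>h > 0\<close> by (simp add: field_simps)
    ultimately show False using pi_gt_zero by linarith
  qed
  have "continuous_on {- (pi / h)..pi / h} g"
    unfolding g_def by (intro continuous_intros) auto
  then obtain t0 where t0: "t0 \<in> {- (pi / h)..pi / h}" "\<And>t. t \<in> {- (pi / h)..pi / h} \<Longrightarrow> g t0 \<le> g t"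
    using continuous_attains_inf[of "{- (pi / h)..pi / h}" g] \<open>h > 0\<close>
    by (metis atLeastatMost_empty_iff compact_Icc divide_nonneg_pos neg_le_0_iff_le order_trans pi_ge_zero)
  show thesis
  proof (rule that[of "g t0"])
    show "g t0 > 0" using t0(1) by (intro g_pos) auto
    show "g t0 * t\<^sup>2 \<le> 1 - Re (mass_cf p B t)" if "\<bar>t\<bar> \<le> pi / h" for t
    proof -
      have "g t0 \<le> g t" using that by (intro t0(2)) (auto simp: abs_le_iff)
      then show ?thesis unfolding gap by (simp add: mult.commute[of "t\<^sup>2"] mult_right_mono)
    qed
  qed
qed

section \<open>Fourier inversion for the urn\<close>

lemma integral_iexp_lattice:
  fixes h :: real and k :: int
  assumes "h > 0"
  shows "(CLBINT t:{- (pi / h)..pi / h}. iexp (t * (h * k))) = (if k = 0 then of_real (2 * pi / h) else 0)"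
proof (cases "k = 0")
  case True
  then show ?thesis using assms by (simp add: set_integral_const scaleR_conv_of_real)
next
  case False
  define c where "c = h * real_of_int k"
  have c: "c \<noteq> 0" using False assms by (simp add: c_def)
  define F where "F t = Complex (sin (t * c) / c) (- cos (t * c) / c)" for t
  have "(CLBINT t:{- (pi / h)..pi / h}. iexp (t * c)) = F (pi / h) - F (- (pi / h))"
    unfolding set_lebesgue_integral_def
  proof (rule integral_FTC_Icc)
    show "- (pi / h) \<le> pi / h" using assms by simp
    show "(F has_vector_derivative iexp (x * c)) (at x within {- (pi / h)..pi / h})" for x
      unfolding F_def using c
      by (auto intro!: derivative_eq_intros simp: has_vector_derivative_complex_iff Re_exp Im_exp)
    show "continuous_on {- (pi / h)..pi / h} (\<lambda>x. iexp (x * c))"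
      by (intro continuous_intros)
  qed
  also have "\<dots> = 0"
  proof -
    have "pi / h * c = pi * k" using assms by (simp add: c_def)
    then show ?thesis by (simp add: F_def complex_eq_iff)
  qed
  finally show ?thesis using False by (simp add: c_def)
qed

lemma mass_cf_mult_iexp:
  "mass_cf p B t * iexp (- (t * y)) = (\<Sum>u\<in>B. p u * iexp (t * (real_of_int u - y)))"
  unfolding mass_cf_def sum_distrib_right mult.assoc exp_add[symmetric]
  by (intro sum.cong) (simp_all add: algebra_simps)

text \<open>
  The recursion \<open>step\<close> is the one satisfied by the law of the selected colour. Passing from \<open>n\<close> to
  \<open>n + 1\<close> multiplies the transform by \<open>(n + 1 + e t) / (n + 2)\<close>: the summand \<open>n + 1\<close> accounts for the
  old contents of the urn, while \<open>e t\<close> shifts the argument \<open>v\<close> by the increments. Hence the inversion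
  formula propagates by induction on \<open>n\<close>, provided that the increments lie on the lattice. The base
  case is the orthogonality of characters, for which the starting points have to lie there too.
\<close>

lemma urn_fourier_inversion:
  fixes q :: "nat \<Rightarrow> int \<Rightarrow> real" and h :: real
  assumes h: "h > 0" and T: "finite T" and B: "finite B"
    and T_lattice: "\<And>v. v \<in> T \<Longrightarrow> real_of_int v \<in> shifted_lattice 0 h"
    and B_lattice: "\<And>u. u \<in> B \<Longrightarrow> p u \<noteq> 0 \<Longrightarrow> real_of_int u \<in> shifted_lattice 0 h"
    and q_outside: "\<And>v. v \<notin> T \<Longrightarrow> q 0 v = 0"
    and step: "\<And>n v. real (Suc (Suc n)) * q (Suc n) v
      = real (Suc n) * q n v + (\<Sum>u\<in>B. p u * q n (v - u))"
    and v: "real_of_int v \<in> shifted_lattice 0 h"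
  shows "(CLBINT t:{- (pi / h)..pi / h}.
      mass_cf (q 0) T t * lazy_product (mass_cf p B t) n * iexp (- (t * v))) = of_real (2 * pi / h * q n v)"
  using v
proof (induction n arbitrary: v)
  let ?I = "{- (pi / h)..pi / h}"
  case 0
  obtain k :: int where k: "real_of_int v = h * k"
    using 0 by (auto simp: shifted_lattice_def)
  have "(CLBINT t:?I. mass_cf (q 0) T t * lazy_product (mass_cf p B t) 0 * iexp (- (t * v)))
      = (CLBINT t:?I. (\<Sum>w\<in>T. q 0 w * iexp (t * (real_of_int w - v))))"
    by (simp only: lazy_product_0 mult_1_right mass_cf_mult_iexp)
  also have "\<dots> = (\<Sum>w\<in>T. q 0 w * (CLBINT t:?I. iexp (t * (real_of_int w - v))))"
    unfolding set_integral_mult_right[symmetric] set_lebesgue_integral_def scaleR_sum_right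
  proof (subst Bochner_Integration.integral_sum)
    show "integrable lborel (\<lambda>t. indicator ?I t *\<^sub>R (q 0 w * iexp (t * (real_of_int w - v))))" for w
      unfolding set_integrable_def[symmetric]
      by (intro borel_integrable_atLeastAtMost' continuous_intros)
  qed (simp only: mult_scaleR_right[symmetric] integral_mult_right_zero)
  also have "\<dots> = (\<Sum>w\<in>T. if w = v then of_real (2 * pi / h * q 0 v) else 0)"
  proof (rule sum.cong)
    fix w assume "w \<in> T"
    then obtain j :: int where j: "real_of_int w = h * j"
      using T_lattice by (auto simp: shifted_lattice_def)
    have "real_of_int w - v = h * of_int (j - k)" by (simp add: j k algebra_simps)
    moreover have "j - k = 0 \<longleftrightarrow> w = v"
    proof -
      have "real_of_int w = real_of_int v \<longleftrightarrow> j = k" using h by (simp add: j k)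
      then show ?thesis by simp
    qed
    ultimately show "q 0 w * (CLBINT t:?I. iexp (t * (real_of_int w - v)))
        = (if w = v then of_real (2 * pi / h * q 0 v) else 0)"
      using integral_iexp_lattice[OF h, of "j - k"] by simp
  qed simp
  also have "\<dots> = of_real (2 * pi / h * q 0 v)"
    using T q_outside[of v] by (simp add: sum.delta)
  finally show ?case .
next
  let ?I = "{- (pi / h)..pi / h}"
  case (Suc n)
  define F where "F t = mass_cf (q 0) T t * lazy_product (mass_cf p B t) n" for t
  have int: "integrable lborel (\<lambda>t. indicator ?I t *\<^sub>R (c * (F t * iexp (- (t * y)))))" for c y
    unfolding set_integrable_def[symmetric] F_def
    by (intro borel_integrable_atLeastAtMost' continuous_intros)
  \<comment> \<open>The induction hypothesis is used at v and at all the shifted points v - u.\<close>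
  have IH: "(CLBINT t:?I. F t * iexp (- (t * w))) = of_real (2 * pi / h * q n w)"
    if "real_of_int w \<in> shifted_lattice 0 h" for w :: int
    using Suc.IH[OF that] by (simp add: F_def)
  let ?N = "of_nat (Suc (Suc n)) :: complex"
  have pointwise: "?N * (mass_cf (q 0) T t * lazy_product (mass_cf p B t) (Suc n) * iexp (- (t * v)))
      = of_nat (Suc n) * (F t * iexp (- (t * v)))
        + (\<Sum>u\<in>B. p u * (F t * iexp (- (t * (real_of_int (v - u))))))" for t :: real
  proof -
    have shift: "mass_cf p B t * iexp (- (t * v))
        = (\<Sum>u\<in>B. p u * iexp (- (t * (real_of_int (v - u)))))"
      unfolding mass_cf_mult_iexp by (simp add: algebra_simps)
    have "?N \<noteq> 0" by (rule of_nat_neq_0)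
    then have "?N * (mass_cf (q 0) T t * lazy_product (mass_cf p B t) (Suc n) * iexp (- (t * v)))
        = F t * (of_nat (Suc n) + mass_cf p B t) * iexp (- (t * v))"
      by (simp add: lazy_product_Suc F_def del: of_nat_Suc)
    also have "\<dots> = of_nat (Suc n) * (F t * iexp (- (t * v)))
        + F t * (\<Sum>u\<in>B. p u * iexp (- (t * (real_of_int (v - u)))))"
      unfolding shift[symmetric] by (simp add: algebra_simps del: of_nat_Suc)
    finally show ?thesis
      by (simp add: sum_distrib_left mult_ac del: of_nat_Suc)
  qed
  have "?N * (CLBINT t:?I. mass_cf (q 0) T t * lazy_product (mass_cf p B t) (Suc n) * iexp (- (t * v)))
      = (CLBINT t:?I. of_nat (Suc n) * (F t * iexp (- (t * v)))
          + (\<Sum>u\<in>B. p u * (F t * iexp (- (t * (real_of_int (v - u)))))))"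
    unfolding set_integral_mult_right[symmetric] by (simp only: pointwise)
  also have "\<dots> = of_nat (Suc n) * (CLBINT t:?I. F t * iexp (- (t * v)))
      + (\<Sum>u\<in>B. p u * (CLBINT t:?I. F t * iexp (- (t * real_of_int (v - u)))))"
    unfolding set_integral_mult_right[symmetric]
    unfolding set_lebesgue_integral_def scaleR_add_right scaleR_sum_right
    by (simp only: Bochner_Integration.integral_add[OF int Bochner_Integration.integrable_sum[OF int]]
        Bochner_Integration.integral_sum[OF int])
  also have "(\<Sum>u\<in>B. p u * (CLBINT t:?I. F t * iexp (- (t * real_of_int (v - u)))))
      = (\<Sum>u\<in>B. of_real (2 * pi / h * (p u * q n (v - u))))"
  proof (rule sum.cong)
    fix u assume u: "u \<in> B"
    show "p u * (CLBINT t:?I. F t * iexp (- (t * real_of_int (v - u))))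
        = of_real (2 * pi / h * (p u * q n (v - u)))"
    proof (cases "p u = 0")
      case False
      obtain i k :: int where "real_of_int u = h * i" "real_of_int v = h * k"
        using B_lattice[OF u False] Suc.prems by (auto simp: shifted_lattice_def)
      then have "real_of_int (v - u) = 0 + h * of_int (k - i)" by (simp add: algebra_simps)
      then have "real_of_int (v - u) \<in> shifted_lattice 0 h" unfolding shifted_lattice_def by blast
      then show ?thesis by (subst IH) simp_all
    qed simp
  qed simp
  also have "of_nat (Suc n) * (CLBINT t:?I. F t * iexp (- (t * v)))
      + (\<Sum>u\<in>B. complex_of_real (2 * pi / h * (p u * q n (v - u))))
      = of_real (2 * pi / h * (real (Suc n) * q n v + (\<Sum>u\<in>B. p u * q n (v - u))))"
    unfolding IH[OF Suc.prems]
    by (simp add: sum_distrib_left algebra_simps sum_divide_distrib add_divide_distrib)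
  also have "\<dots> = ?N * of_real (2 * pi / h * q (Suc n) v)"
    unfolding step[symmetric] by (simp add: mult_ac del: of_nat_Suc)
  finally show ?case
    using of_nat_neq_0[of "Suc n", where 'a=complex] by (simp only: mult_cancel_left simp_thms)
qed

section \<open>Convergence of the rescaled characteristic functions\<close>

lemma urn_cf_dominated:
  fixes \<kappa> h :: real and p q :: "int \<Rightarrow> real"
  assumes q: "\<And>v. q v \<ge> 0" "sum q T = 1" and p: "\<And>u. p u \<ge> 0" "sum p B = 1"
    and gap: "\<And>t. \<bar>t\<bar> \<le> pi / h \<Longrightarrow> \<kappa> * t\<^sup>2 \<le> 1 - Re (mass_cf p B t)"
    and n: "n \<ge> 1" and t: "\<bar>t\<bar> \<le> pi / h"
  shows "cmod (mass_cf q T t * lazy_product (mass_cf p B t) n) \<le> exp 4 * exp (- (\<kappa> * t\<^sup>2 * ln (real n)))"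
proof -
  have "cmod (mass_cf q T t * lazy_product (mass_cf p B t) n)
      \<le> 1 * (exp 4 * exp (- ((1 - Re (mass_cf p B t)) * ln (real n))))"
    unfolding norm_mult
    by (intro mult_mono norm_mass_cf_le_1 norm_lazy_product_le q p n) auto
  also have "\<dots> \<le> exp 4 * exp (- (\<kappa> * t\<^sup>2 * ln (real n)))"
    using mult_right_mono[OF gap[OF t], of "ln (real n)"] n by simp
  finally show ?thesis .
qed

text \<open>
  At \<open>t = s / (\<sigma> sqrt L)\<close> with \<open>L = ln n\<close>, the product is asymptotically \<open>exp (L (e t - 1))\<close>, and
  \<open>L (e t - 1) = \<i> \<mu> s sqrt L / \<sigma> - s\<^sup>2 / 2 + O(1 / sqrt L)\<close>. The number of steps taken by the
  walk is itself random with mean and variance close to \<open>L\<close>. This is why no logarithm of \<open>e\<close>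
  appears in the exponent and the second moment \<open>\<sigma>\<^sup>2\<close> takes the place of the variance.
\<close>

lemma urn_cf_tendsto:
  fixes \<sigma> s :: real and p q :: "int \<Rightarrow> real"
  assumes q: "\<And>v. q v \<ge> 0" "sum q T = 1" and p: "\<And>u. p u \<ge> 0" "sum p B = 1"
    and mean: "\<mu> = (\<Sum>u\<in>B. p u * u)" and second_moment: "\<sigma>\<^sup>2 = (\<Sum>u\<in>B. p u * (real_of_int u)\<^sup>2)"
    and \<sigma>: "\<sigma> > 0"
  defines "c \<equiv> \<lambda>n. \<sigma> * sqrt (ln (real n))"
  shows "(\<lambda>n. mass_cf q T (s / c n) * lazy_product (mass_cf p B (s / c n)) n
      * iexp (- (s * (\<mu> * ln (real n) / c n)))) \<longlonglongrightarrow> of_real (exp (- s\<^sup>2 / 2))"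
proof -
  define t where "t n = s / c n" for n :: nat
  define L where "L n = ln (real n)" for n :: nat
  define e where "e n = mass_cf p B (t n)" for n
  define m3 where "m3 = (\<Sum>u\<in>B. p u * \<bar>real_of_int u\<bar>^3)"
  have L_top: "filterlim L at_top sequentially"
    unfolding L_def by (rule filterlim_compose[OF ln_at_top filterlim_real_sequentially])
  have L_pos: "\<forall>\<^sub>F n in sequentially. L n > 0"
    using L_top unfolding filterlim_at_top_dense by blast
  have c_top: "filterlim c at_top sequentially"
    unfolding c_def using \<sigma> L_top[unfolded L_def]
    by (intro filterlim_tendsto_pos_mult_at_top[OF tendsto_const] filterlim_compose[OF sqrt_at_top]) auto
  have t0: "t \<longlonglongrightarrow> 0"
    unfolding t_def by (rule real_tendsto_divide_at_top[OF tendsto_const c_top])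
  have start: "(\<lambda>n. mass_cf q T (t n)) \<longlonglongrightarrow> 1"
  proof -
    have "isCont (mass_cf q T) 0"
      using continuous_mass_cf[OF continuous_on_id, of UNIV q T]
      by (simp add: continuous_on_eq_continuous_within)
    then show ?thesis using isCont_tendsto_compose[OF _ t0, of "mass_cf q T"] mass_cf_0[OF q(2)] by simp
  qed
  have e1: "e \<longlonglongrightarrow> 1"
  proof -
    have "isCont (mass_cf p B) 0"
      using continuous_mass_cf[OF continuous_on_id, of UNIV p B]
      by (simp add: continuous_on_eq_continuous_within)
    then show ?thesis
      unfolding e_def using isCont_tendsto_compose[OF _ t0, of "mass_cf p B"] mass_cf_0[OF p(2)] by simp
  qed
  \<comment> \<open>The remainder of third order in t contributes L * t^3, which is of order 1 / sqrt L.\<close>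
  have exponent: "(\<lambda>n. (e n - 1) * L n - \<i> * of_real (s * (\<mu> * L n / c n))) \<longlonglongrightarrow> - of_real (s\<^sup>2 / 2)"
  proof (rule LIM_zero_cancel, rule Lim_null_comparison)
    show "(\<lambda>n. \<bar>s\<bar>^3 * m3 / \<sigma>\<^sup>2 / c n) \<longlonglongrightarrow> 0"
      by (rule real_tendsto_divide_at_top[OF tendsto_const c_top])
    show "\<forall>\<^sub>F n in sequentially. cmod ((e n - 1) * L n - \<i> * of_real (s * (\<mu> * L n / c n))
        - (- of_real (s\<^sup>2 / 2))) \<le> \<bar>s\<bar>^3 * m3 / \<sigma>\<^sup>2 / c n"
      using L_pos
    proof eventually_elim
      case (elim n)
      have c2: "(c n)\<^sup>2 = \<sigma>\<^sup>2 * L n" and cpos: "c n > 0"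
        using elim \<sigma> by (simp_all add: c_def L_def power_mult_distrib)
      have "(t n)\<^sup>2 * \<sigma>\<^sup>2 / 2 * L n = s\<^sup>2 / 2"
        using \<sigma> elim by (simp add: t_def power_divide c2)
      then have "complex_of_real (s\<^sup>2 / 2) = of_real ((t n)\<^sup>2 * \<sigma>\<^sup>2 / 2) * of_real (L n)"
        by (metis of_real_mult)
      then have "(e n - 1) * L n - \<i> * of_real (s * (\<mu> * L n / c n)) - (- of_real (s\<^sup>2 / 2))
         = (e n - (1 + \<i> * of_real (t n * \<mu>) - of_real ((t n)\<^sup>2 * \<sigma>\<^sup>2 / 2))) * L n"
        by (simp add: algebra_simps t_def)
      also have "cmod \<dots> \<le> \<bar>t n\<bar>^3 * m3 * L n"
        using mass_cf_expansion[OF p, where t = "t n"] elim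
        by (simp add: norm_mult e_def m3_def mean second_moment mult_right_mono)
      also have "\<bar>t n\<bar>^3 = \<bar>s\<bar>^3 / (\<sigma>\<^sup>2 * L n * c n)"
        unfolding c2[symmetric] using cpos by (simp add: t_def power_divide power3_eq_cube power2_eq_square abs_mult)
      also have "\<dots> * m3 * L n = \<bar>s\<bar>^3 * m3 / \<sigma>\<^sup>2 / c n"
        using elim by simp
      finally show ?case .
    qed
  qed
  have prod: "(\<lambda>n. (lazy_product (e n) n - exp ((e n - 1) * L n)) * iexp (- (s * (\<mu> * L n / c n)))) \<longlonglongrightarrow> 0"
  proof (rule Lim_null_comparison)
    show "(\<lambda>n. 3 * exp 2 * cmod (e n - 1)) \<longlonglongrightarrow> 0"
      using tendsto_mult[OF tendsto_const tendsto_norm[OF tendsto_diff[OF e1 tendsto_const]], of "3 * exp 2" 1]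
      by simp
    show "\<forall>\<^sub>F n in sequentially. cmod ((lazy_product (e n) n - exp ((e n - 1) * L n))
        * iexp (- (s * (\<mu> * L n / c n)))) \<le> 3 * exp 2 * cmod (e n - 1)"
      using eventually_ge_at_top[of 1]
    proof eventually_elim
      case (elim n)
      then show ?case
        using lazy_product_near_power[of "e n" n] norm_mass_cf_le_1[OF p]
        by (simp add: norm_mult e_def L_def)
    qed
  qed
  have "(\<lambda>n. exp ((e n - 1) * L n) * iexp (- (s * (\<mu> * L n / c n)))) \<longlonglongrightarrow> exp (- of_real (s\<^sup>2 / 2))"
    using tendsto_exp[OF exponent] by (simp add: mult_exp_exp)
  from tendsto_mult[OF start tendsto_add[OF prod this]]
  show ?thesis
    by (simp add: e_def t_def L_def algebra_simps flip: exp_of_real)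
qed

text \<open>
  On the range of integration the majorant is
  \<open>exp (- \<kappa> t\<^sup>2 ln n) = exp (- \<kappa> s\<^sup>2 / \<sigma>\<^sup>2)\<close>, which is the same for all \<open>n\<close>.
\<close>

lemma urn_cf_L1_convergence:
  fixes \<sigma> h \<kappa> :: real and p q :: "int \<Rightarrow> real"
  assumes q: "\<And>v. q v \<ge> 0" "sum q T = 1" and p: "\<And>u. p u \<ge> 0" "sum p B = 1"
    and mean: "\<mu> = (\<Sum>u\<in>B. p u * u)" and second_moment: "\<sigma>\<^sup>2 = (\<Sum>u\<in>B. p u * (real_of_int u)\<^sup>2)"
    and \<sigma>: "\<sigma> > 0" and h: "h > 0"
    and gap: "\<kappa> > 0" "\<And>t. \<bar>t\<bar> \<le> pi / h \<Longrightarrow> \<kappa> * t\<^sup>2 \<le> 1 - Re (mass_cf p B t)"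
  defines "c \<equiv> \<lambda>n. \<sigma> * sqrt (ln (real n))"
  defines "D \<equiv> \<lambda>n s. indicator {- (pi / h)..pi / h} (s / c n) *\<^sub>R
          (mass_cf q T (s / c n) * lazy_product (mass_cf p B (s / c n)) n
            * iexp (- (s * (\<mu> * ln (real n) / c n)))) - of_real (exp (- s\<^sup>2 / 2))"
  shows "(\<lambda>n. LINT s|lborel. cmod (D n s)) \<longlonglongrightarrow> 0"
proof -
  let ?I = "{- (pi / h)..pi / h}"
  define w where "w s = exp 4 * exp (- (\<kappa> / \<sigma>\<^sup>2 * s\<^sup>2)) + exp (- s\<^sup>2 / 2)" for s
  have gauss: "integrable lborel (\<lambda>s. exp (- (b * s\<^sup>2)) :: real)" if "b > 0" for b
  proof -
    define \<tau> where "\<tau> = sqrt (1 / (2 * b))"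
    have \<tau>: "\<tau> > 0" "\<tau>\<^sup>2 = 1 / (2 * b)" using that by (simp_all add: \<tau>_def)
    have "integrable lborel (\<lambda>s. sqrt (2 * pi * \<tau>\<^sup>2) * normal_density 0 \<tau> s)"
      using \<tau> by (intro integrable_mult_right integrable_normal_density)
    also have "(\<lambda>s. sqrt (2 * pi * \<tau>\<^sup>2) * normal_density 0 \<tau> s) = (\<lambda>s. exp (- (b * s\<^sup>2)))"
      using that by (simp add: normal_density_def \<tau> fun_eq_iff mult.commute)
    finally show ?thesis .
  qed
  have w_int: "integrable lborel w"
    unfolding w_def using gauss[of "\<kappa> / \<sigma>\<^sup>2"] gauss[of "1/2"] gap(1) \<sigma>
    by (intro Bochner_Integration.integrable_add integrable_mult_right) simp_all
  have "continuous_on UNIV (\<lambda>t. mass_cf q T t)" "continuous_on UNIV (\<lambda>t. lazy_product (mass_cf p B t) n)" for n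
    by (intro continuous_intros)+
  then have [measurable]: "mass_cf q T \<in> borel_measurable borel" 
     "(\<lambda>t. lazy_product (mass_cf p B t) n) \<in> borel_measurable borel" for n
    by (auto intro: borel_measurable_continuous_onI)
  have D_meas: "D n \<in> borel_measurable lborel" for n
    unfolding D_def by measurable
  have bound: "cmod (D n s) \<le> w s" if n: "n \<ge> 2" for n s
  proof -
    have L: "ln (real n) > 0" using n by simp
    have c2: "(s / c n)\<^sup>2 * ln (real n) = s\<^sup>2 / \<sigma>\<^sup>2"
      using L by (simp add: c_def power_divide power_mult_distrib)
    have "cmod (indicator ?I (s / c n) *\<^sub>R
          (mass_cf q T (s / c n) * lazy_product (mass_cf p B (s / c n)) n
            * iexp (- (s * (\<mu> * ln (real n) / c n))))) \<le> exp 4 * exp (- (\<kappa> / \<sigma>\<^sup>2 * s\<^sup>2))"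
    proof (cases "s / c n \<in> ?I")
      case True
      then have "\<bar>s / c n\<bar> \<le> pi / h" by (auto simp: abs_le_iff)
      then have "cmod (mass_cf q T (s / c n) * lazy_product (mass_cf p B (s / c n)) n)
          \<le> exp 4 * exp (- (\<kappa> * (s / c n)\<^sup>2 * ln (real n)))"
        using n by (intro urn_cf_dominated[OF q p gap(2)]) auto
      also have "\<kappa> * (s / c n)\<^sup>2 * ln (real n) = \<kappa> / \<sigma>\<^sup>2 * s\<^sup>2"
        unfolding mult.assoc c2 by simp
      finally show ?thesis using True by (simp add: norm_mult)
    qed simp
    then show ?thesis
      unfolding D_def w_def by (intro order_trans[OF norm_triangle_ineq4] add_mono) auto
  qed
  have lim: "(\<lambda>n. D n s) \<longlonglongrightarrow> 0" for s
  proof -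
    have L_top: "filterlim (\<lambda>n. ln (real n)) at_top sequentially"
      by (rule filterlim_compose[OF ln_at_top filterlim_real_sequentially])
    have c_top: "filterlim c at_top sequentially"
      unfolding c_def using \<sigma> L_top
      by (intro filterlim_tendsto_pos_mult_at_top[OF tendsto_const] filterlim_compose[OF sqrt_at_top]) auto
    have "(\<lambda>n. s / c n) \<longlonglongrightarrow> 0"
      by (rule real_tendsto_divide_at_top[OF tendsto_const c_top])
    then have "\<forall>\<^sub>F n in sequentially. s / c n \<in> {- (pi / h)<..<pi / h}"
      by (rule topological_tendstoD) (use h in auto)
    then have ev: "\<forall>\<^sub>F n in sequentially. indicator ?I (s / c n) *\<^sub>R
          (mass_cf q T (s / c n) * lazy_product (mass_cf p B (s / c n)) n
            * iexp (- (s * (\<mu> * ln (real n) / c n))))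
        = mass_cf q T (s / c n) * lazy_product (mass_cf p B (s / c n)) n
            * iexp (- (s * (\<mu> * ln (real n) / c n)))"
      by eventually_elim auto
    have "(\<lambda>n. indicator ?I (s / c n) *\<^sub>R
          (mass_cf q T (s / c n) * lazy_product (mass_cf p B (s / c n)) n
            * iexp (- (s * (\<mu> * ln (real n) / c n))))) \<longlonglongrightarrow> of_real (exp (- s\<^sup>2 / 2))"
      unfolding tendsto_cong[OF ev] unfolding c_def
      by (rule urn_cf_tendsto[OF q p mean second_moment \<sigma>])
    from tendsto_diff[OF this tendsto_const[of "of_real (exp (- s\<^sup>2 / 2))"]]
    show ?thesis by (simp add: D_def)
  qed
  \<comment> \<open>For n < 2 the scale c n is 0, so domination is available only from n = 2 on.\<close>
  have "(\<lambda>n. LINT s|lborel. cmod (D (n + 2) s)) \<longlonglongrightarrow> integral\<^sup>L (lborel :: real measure) (\<lambda>_. 0 :: real)"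
  proof (rule integral_dominated_convergence[where w = w])
    show "integrable lborel w" by (rule w_int)
    show "AE s in lborel. (\<lambda>n. cmod (D (n + 2) s)) \<longlonglongrightarrow> 0"
      using LIMSEQ_ignore_initial_segment[OF lim] by (intro AE_I2 tendsto_norm_zero)
    show "AE s in lborel. norm (cmod (D (n + 2) s)) \<le> w s" for n
      using bound[of "n + 2"] by (intro AE_I2) simp
    show "(\<lambda>s. cmod (D (n + 2) s)) \<in> borel_measurable lborel" for n
      using D_meas by measurable
  qed simp
  then have "(\<lambda>n. LINT s|lborel. cmod (D (n + 2) s)) \<longlonglongrightarrow> 0" by simp
  then show ?thesis by (rule LIMSEQ_offset)
qed

section \<open>The local limit theorem for the urn recursion\<close>

lemma std_normal_fourier_inversion:
  "(CLINT s|lborel. of_real (exp (- s\<^sup>2 / 2)) * iexp (- (s * x))) = of_real (2 * pi * std_normal_density x)"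
proof -
  have "complex_of_real (exp (- x\<^sup>2 / 2)) = char std_normal_distribution (- x)"
    by (simp add: char_std_normal_distribution)
  also have "\<dots> = (CLINT s|lborel. std_normal_density s *\<^sub>R iexp (- x * s))"
    unfolding char_def by (subst integral_density) auto
  also have "\<dots> = (CLINT s|lborel. of_real (1 / sqrt (2 * pi)) * (of_real (exp (- s\<^sup>2 / 2)) * iexp (- (s * x))))"
    by (intro Bochner_Integration.integral_cong) (auto simp: std_normal_density_def scaleR_conv_of_real mult_ac)
  also have "\<dots> = of_real (1 / sqrt (2 * pi)) * (CLINT s|lborel. of_real (exp (- s\<^sup>2 / 2)) * iexp (- (s * x)))"
    by (rule integral_mult_right_zero)
  finally have "of_real (sqrt (2 * pi)) * complex_of_real (exp (- x\<^sup>2 / 2))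
      = (CLINT s|lborel. of_real (exp (- s\<^sup>2 / 2)) * iexp (- (s * x)))"
    by simp
  moreover have "sqrt (2 * pi) * exp (- x\<^sup>2 / 2) = 2 * pi * std_normal_density x"
  proof -
    define r where "r = sqrt (2 * pi)"
    have r: "r \<noteq> 0" "r * r = 2 * pi" by (simp_all add: r_def)
    have "2 * pi * std_normal_density x = r * r * (exp (- x\<^sup>2 / 2) / r)"
      unfolding r(2) by (simp add: std_normal_density_def r_def)
    also have "\<dots> = r * exp (- x\<^sup>2 / 2)"
      using r(1) by simp
    finally show ?thesis by (simp add: r_def)
  qed
  ultimately show ?thesis by (metis of_real_mult)
qed

lemma integrable_gaussian_iexp:
  "integrable lborel (\<lambda>s. of_real (exp (- s\<^sup>2 / 2)) * iexp (- (s * x)))"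
proof -
  have "integrable lborel (\<lambda>s. sqrt (2 * pi) * std_normal_density s)"
    by (intro integrable_mult_right integrable_normal_density) simp
  then have "integrable lborel (\<lambda>s::real. exp (- s\<^sup>2 / 2))"
    by (simp add: std_normal_density_def)
  then show ?thesis
    by (rule Bochner_Integration.integrable_bound) (auto simp: norm_mult)
qed

text \<open>
  After the substitution \<open>t = s / c n\<close> in the inversion formula, the rescaled probability at \<open>v\<close> and
  the Gaussian density at the corresponding point \<open>x\<close> are Fourier integrals against the same character
  \<open>exp (- \<i> s x)\<close>. So their difference is at most the \<open>L\<^sup>1\<close> distance of the two transforms, which
  does not depend on \<open>v\<close>; this is the source of uniformity.
\<close>

lemma urn_local_limit:
  fixes q :: "nat \<Rightarrow> int \<Rightarrow> real" and p :: "int \<Rightarrow> real" and \<sigma> h :: real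
  assumes T: "finite T" "\<And>v. q 0 v \<ge> 0" "sum (q 0) T = 1" "\<And>v. v \<notin> T \<Longrightarrow> q 0 v = 0"
    and T_lattice: "\<And>v. v \<in> T \<Longrightarrow> real_of_int v \<in> shifted_lattice 0 h"
    and p: "finite B" "\<And>u. p u \<ge> 0" "sum p B = 1"
    and B_lattice: "\<And>u. u \<in> B \<Longrightarrow> p u \<noteq> 0 \<Longrightarrow> real_of_int u \<in> shifted_lattice 0 h"
    and maximal: "\<And>d. d > 0 \<Longrightarrow> (\<And>u. u \<in> B \<Longrightarrow> p u > 0 \<Longrightarrow> real_of_int u \<in> shifted_lattice 0 d) \<Longrightarrow> d \<le> h"
    and step: "\<And>n v. real (Suc (Suc n)) * q (Suc n) v
      = real (Suc n) * q n v + (\<Sum>u\<in>B. p u * q n (v - u))"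
    and mean: "\<mu> = (\<Sum>u\<in>B. p u * u)" and second_moment: "\<sigma>\<^sup>2 = (\<Sum>u\<in>B. p u * (real_of_int u)\<^sup>2)"
    and \<sigma>: "\<sigma> > 0" and h: "h > 0"
  defines "c \<equiv> \<lambda>n. \<sigma> * sqrt (ln (real n))"
  obtains \<epsilon> where "\<epsilon> \<longlonglongrightarrow> 0"
    "\<And>n v. n \<ge> 2 \<Longrightarrow> real_of_int v \<in> shifted_lattice 0 h \<Longrightarrow>
      \<bar>c n / h * q n v - std_normal_density ((v - \<mu> * ln (real n)) / c n)\<bar> \<le> \<epsilon> n"
proof -
  let ?I = "{- (pi / h)..pi / h}"
  obtain u0 where u0: "u0 \<in> B" "u0 \<noteq> 0" "p u0 > 0"
  proof -
    have "(\<Sum>u\<in>B. p u * (real_of_int u)\<^sup>2) \<noteq> 0"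
      using \<sigma> by (simp flip: second_moment)
    then obtain u where "u \<in> B" "p u * (real_of_int u)\<^sup>2 \<noteq> 0"
      by (rule sum.not_neutral_contains_not_neutral)
    then show thesis using that[of u] p(2)[of u] by simp
  qed
  obtain \<kappa> where \<kappa>: "\<kappa> > 0" "\<And>t. \<bar>t\<bar> \<le> pi / h \<Longrightarrow> \<kappa> * t\<^sup>2 \<le> 1 - Re (mass_cf p B t)"
    using one_minus_Re_mass_cf_ge[OF p h u0 maximal] by blast
  define \<Psi> where "\<Psi> n t = mass_cf (q 0) T t * lazy_product (mass_cf p B t) n" for n t
  define D where "D n s = indicator ?I (s / c n) *\<^sub>R (\<Psi> n (s / c n) * iexp (- (s * (\<mu> * ln (real n) / c n))))
      - of_real (exp (- s\<^sup>2 / 2))" for n s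
  define \<epsilon> where "\<epsilon> n = (LINT s|lborel. cmod (D n s)) / (2 * pi)" for n
  have "(\<lambda>n. LINT s|lborel. cmod (D n s)) \<longlonglongrightarrow> 0"
    unfolding D_def \<Psi>_def c_def
    by (rule urn_cf_L1_convergence[OF T(2,3) p(2,3) mean second_moment \<sigma> h \<kappa>])
  then have "\<epsilon> \<longlonglongrightarrow> 0"
    unfolding \<epsilon>_def by (rule tendsto_divide_zero)
  moreover have "\<bar>c n / h * q n v - std_normal_density ((v - \<mu> * ln (real n)) / c n)\<bar> \<le> \<epsilon> n"
    if n: "n \<ge> 2" and v: "real_of_int v \<in> shifted_lattice 0 h" for n v
  proof -
    define x where "x = (v - \<mu> * ln (real n)) / c n"
    have c: "c n > 0" using n \<sigma> by (simp add: c_def)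
    define G where "G t = indicator ?I t *\<^sub>R (\<Psi> n t * iexp (- (t * v)))" for t
    have G_int: "integrable lborel G"
      unfolding G_def \<Psi>_def set_integrable_def[symmetric]
      by (intro borel_integrable_atLeastAtMost' continuous_intros)
    have "(CLINT t|lborel. G t) = of_real (2 * pi / h * q n v)"
      using urn_fourier_inversion[OF h T(1) p(1) T_lattice B_lattice T(4) step v]
      by (simp add: G_def \<Psi>_def set_lebesgue_integral_def)
    moreover have "(CLINT t|lborel. G t) = (1 / c n) *\<^sub>R (CLINT s|lborel. G (s / c n))"
      using lborel_integral_real_affine[of "1 / c n" G 0] c by simp
    ultimately have G_val: "(CLINT s|lborel. G (s / c n)) = of_real (2 * pi * (c n / h * q n v))"
      using c by (simp add: scaleR_conv_of_real field_simps)
    have G_scaled: "integrable lborel (\<lambda>s. G (s / c n))"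
      using lborel_integrable_real_affine[OF G_int, of "1 / c n" 0] c by simp
    have D_eq: "D n s * iexp (- (s * x)) = G (s / c n) - of_real (exp (- s\<^sup>2 / 2)) * iexp (- (s * x))" for s
    proof -
      have "s * (\<mu> * ln (real n) / c n) + s * x = s / c n * v"
        using c by (simp add: x_def field_simps)
      then have "iexp (- (s * (\<mu> * ln (real n) / c n))) * iexp (- (s * x)) = iexp (- (s / c n * v))"
        unfolding mult_exp_exp by (metis minus_add_distrib of_real_add distrib_left)
      then show ?thesis by (simp only: D_def G_def left_diff_distrib mult_scaleR_left mult.assoc)
    qed
    have "(CLINT s|lborel. D n s * iexp (- (s * x)))
        = of_real (2 * pi * (c n / h * q n v)) - of_real (2 * pi * std_normal_density x)"
      unfolding D_eq
      by (simp only: Bochner_Integration.integral_diff[OF G_scaled integrable_gaussian_iexp]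
          G_val std_normal_fourier_inversion)
    also have "\<dots> = of_real (2 * pi * (c n / h * q n v - std_normal_density x))"
      by (simp only: right_diff_distrib of_real_diff)
    finally have "2 * pi * \<bar>c n / h * q n v - std_normal_density x\<bar>
        = cmod (CLINT s|lborel. D n s * iexp (- (s * x)))"
      by (simp only: norm_of_real abs_mult) simp
    also have "\<dots> \<le> (LINT s|lborel. cmod (D n s * iexp (- (s * x))))"
      by (rule integral_norm_bound)
    also have "\<dots> = (LINT s|lborel. cmod (D n s))"
      by (simp add: norm_mult)
    finally show ?thesis
      by (simp add: \<epsilon>_def x_def field_simps)
  qed
  ultimately show thesis using that by blast
qed

section \<open>The law of the selected colour\<close>

lemma subalgebra_urn_history:
  assumes "\<And>k v. (\<lambda>\<omega>. U k \<omega> v) \<in> borel_measurable M"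
  shows "subalgebra M (urn_history M U n)"
proof -
  let ?G = "\<Union>k\<le>n. \<Union>v. {(\<lambda>\<omega>. U k \<omega> v) -` A \<inter> space M | A. A \<in> sets borel}"
  have "?G \<subseteq> sets M" using assms by (auto intro: measurable_sets)
  moreover have "?G \<subseteq> Pow (space M)" by blast
  ultimately show ?thesis
    unfolding subalgebra_def urn_history_def
    by (simp add: sets.sigma_sets_subset space_measure_of sets_measure_of)
qed

text \<open>
  Taking expectations in the conditional law of \<open>Z n\<close> shows that \<open>q n v\<close> is the mean content of
  colour \<open>v\<close> divided by \<open>n + 1\<close>, and the mean content grows by the mean of \<open>p (v - Z n)\<close>. This closes
  into a linear recursion for the laws alone.
\<close>

lemma urn_colour_law:
  assumes p: "finite B" "\<And>u. u \<notin> B \<Longrightarrow> p u = 0"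
    and urn: "infinite_color_urn M p U0 U Z"
  defines "q \<equiv> \<lambda>n v. measure M {\<omega> \<in> space M. Z n \<omega> = v}"
  shows "q 0 v = U0 v"
    and "real (Suc (Suc n)) * q (Suc n) v = real (Suc n) * q n v + (\<Sum>u\<in>B. p u * q n (v - u))"
proof -
  interpret prob_space M using urn by (simp add: infinite_color_urn_def)
  have Z [measurable]: "Z n \<in> measurable M (count_space UNIV)" for n
    using urn by (simp add: infinite_color_urn_def)
  have U_0: "U 0 \<omega> v = U0 v" if "\<omega> \<in> space M" for \<omega> v
    using urn that by (simp add: infinite_color_urn_def)
  have U_Suc: "U (Suc n) \<omega> v = U n \<omega> v + p (v - Z n \<omega>)" if "\<omega> \<in> space M" for n \<omega> v
    using urn that by (simp add: infinite_color_urn_def replacement_def)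
  have event [measurable]: "{\<omega> \<in> space M. Z n \<omega> = v} \<in> sets M" for n v
    by measurable
  have int_ind: "integrable M (indicator {\<omega> \<in> space M. Z n \<omega> = v} :: _ \<Rightarrow> real)" for n v
    by (simp add: less_top[symmetric])
  have added: "p (v - Z n \<omega>) = (\<Sum>u\<in>B. p u * indicator {\<omega> \<in> space M. Z n \<omega> = v - u} \<omega>)"
    if "\<omega> \<in> space M" for n v \<omega>
  proof -
    have "(\<Sum>u\<in>B. p u * indicator {\<omega> \<in> space M. Z n \<omega> = v - u} \<omega>)
        = (\<Sum>u\<in>B. if u = v - Z n \<omega> then p u else 0)"
      using that by (intro sum.cong) (auto simp: indicator_def)
    then show ?thesis using p by (auto simp: sum.delta)
  qed
  have added_int: "integrable M (\<lambda>\<omega>. p (v - Z n \<omega>))"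
    and added_val: "expectation (\<lambda>\<omega>. p (v - Z n \<omega>)) = (\<Sum>u\<in>B. p u * q n (v - u))" for n v
  proof -
    have "integrable M (\<lambda>\<omega>. \<Sum>u\<in>B. p u * indicator {\<omega> \<in> space M. Z n \<omega> = v - u} \<omega>)"
      by (intro Bochner_Integration.integrable_sum integrable_mult_right int_ind)
    then show "integrable M (\<lambda>\<omega>. p (v - Z n \<omega>))"
      by (subst Bochner_Integration.integrable_cong[OF refl added])
    have "expectation (\<lambda>\<omega>. p (v - Z n \<omega>))
        = expectation (\<lambda>\<omega>. \<Sum>u\<in>B. p u * indicator {\<omega> \<in> space M. Z n \<omega> = v - u} \<omega>)"
      by (intro Bochner_Integration.integral_cong refl added)
    also have "\<dots> = (\<Sum>u\<in>B. expectation (\<lambda>\<omega>. p u * indicator {\<omega> \<in> space M. Z n \<omega> = v - u} \<omega>))"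
      by (intro Bochner_Integration.integral_sum integrable_mult_right int_ind)
    also have "\<dots> = (\<Sum>u\<in>B. p u * q n (v - u))"
      by (simp add: q_def)
    finally show "expectation (\<lambda>\<omega>. p (v - Z n \<omega>)) = (\<Sum>u\<in>B. p u * q n (v - u))" .
  qed
  have U_int: "integrable M (\<lambda>\<omega>. U n \<omega> v)" for n v
  proof (induction n)
    case 0
    show ?case by (subst Bochner_Integration.integrable_cong[OF refl U_0]) auto
  next
    case (Suc n)
    then have "integrable M (\<lambda>\<omega>. U n \<omega> v + p (v - Z n \<omega>))"
      by (intro Bochner_Integration.integrable_add added_int)
    then show ?case by (subst Bochner_Integration.integrable_cong[OF refl U_Suc])
  qed
  note borel_measurable_integrable[OF U_int, measurable]
  have mean_U: "expectation (\<lambda>\<omega>. U n \<omega> v) = real (Suc n) * q n v" for n v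
  proof -
    interpret finite_measure_subalgebra M "urn_history M U n"
      by unfold_locales (intro subalgebra_urn_history borel_measurable_integrable U_int)
    let ?E = "real_cond_exp M (urn_history M U n) (indicator {\<omega> \<in> space M. Z n \<omega> = v})"
    have "AE \<omega> in M. ?E \<omega> = U n \<omega> v / real (n + 1)"
      using urn by (simp add: infinite_color_urn_def)
    then have "expectation ?E = expectation (\<lambda>\<omega>. U n \<omega> v / real (n + 1))"
      by (intro integral_cong_AE) measurable
    moreover have "expectation ?E = q n v"
      using real_cond_exp_int(2)[OF int_ind[of n v]] by (simp add: q_def)
    ultimately show ?thesis by simp
  qed
  show "q 0 v = U0 v"
  proof -
    have "expectation (\<lambda>\<omega>. U 0 \<omega> v) = expectation (\<lambda>\<omega>. U0 v)"
      by (intro Bochner_Integration.integral_cong refl U_0)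
    then show ?thesis using mean_U[of 0 v] by (simp add: prob_space)
  qed
  have "real (Suc (Suc n)) * q (Suc n) v = expectation (\<lambda>\<omega>. U (Suc n) \<omega> v)"
    by (rule mean_U[symmetric])
  also have "\<dots> = expectation (\<lambda>\<omega>. U n \<omega> v + p (v - Z n \<omega>))"
    by (intro Bochner_Integration.integral_cong refl U_Suc)
  also have "\<dots> = real (Suc n) * q n v + (\<Sum>u\<in>B. p u * q n (v - u))"
    by (simp only: Bochner_Integration.integral_add[OF U_int added_int] mean_U added_val)
  finally show "real (Suc (Suc n)) * q (Suc n) v = real (Suc n) * q n v + (\<Sum>u\<in>B. p u * q n (v - u))" .
qed

section \<open>Finitely supported laws on the integers and their span\<close>

lemma (in prob_space) finite_support_law:
  fixes Y :: "'a \<Rightarrow> int"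
  assumes Y: "Y \<in> measurable M (count_space UNIV)"
    and B: "finite B" "\<And>u. u \<notin> B \<Longrightarrow> pmf_at M Y u = 0"
  shows "expectation (\<lambda>\<omega>. f (Y \<omega>)) = (\<Sum>u\<in>B. pmf_at M Y u * f u)"
    and "measure M {\<omega> \<in> space M. Y \<omega> \<in> S} = 1 \<longleftrightarrow> (\<forall>u. pmf_at M Y u > 0 \<longrightarrow> u \<in> S)"
proof -
  note Y [measurable]
  have event [measurable]: "{\<omega> \<in> space M. Y \<omega> \<in> S} \<in> sets M" for S
    by measurable
  have event1 [measurable]: "{\<omega> \<in> space M. Y \<omega> = u} \<in> sets M" for u
    by measurable
  have null: "(AE \<omega> in M. Y \<omega> \<noteq> u) \<longleftrightarrow> pmf_at M Y u = 0" for u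
    by (subst AE_iff_measurable[OF event1]) (auto simp: pmf_at_def emeasure_eq_measure)
  have "AE \<omega> in M. \<forall>u. pmf_at M Y u = 0 \<longrightarrow> Y \<omega> \<noteq> u"
    unfolding AE_all_countable using null by auto
  then have pos: "AE \<omega> in M. pmf_at M Y (Y \<omega>) > 0"
    by eventually_elim (auto simp: pmf_at_def zero_less_measure_iff)
  show "expectation (\<lambda>\<omega>. f (Y \<omega>)) = (\<Sum>u\<in>B. pmf_at M Y u * f u)"
  proof -
    have "expectation (\<lambda>\<omega>. f (Y \<omega>))
        = expectation (\<lambda>\<omega>. \<Sum>u\<in>B. f u * indicator {\<omega> \<in> space M. Y \<omega> = u} \<omega>)"
    proof (rule integral_cong_AE)
      show "AE \<omega> in M. f (Y \<omega>) = (\<Sum>u\<in>B. f u * indicator {\<omega> \<in> space M. Y \<omega> = u} \<omega>)"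
        using pos AE_space
      proof eventually_elim
        case (elim \<omega>)
        have "(\<Sum>u\<in>B. f u * indicator {\<omega> \<in> space M. Y \<omega> = u} \<omega>) = (\<Sum>u\<in>B. if u = Y \<omega> then f u else 0)"
          using elim by (intro sum.cong) (auto simp: indicator_def)
        also have "\<dots> = f (Y \<omega>)" using B elim by (auto simp: sum.delta)
        finally show ?case by simp
      qed
    qed measurable
    also have "\<dots> = (\<Sum>u\<in>B. expectation (\<lambda>\<omega>. f u * indicator {\<omega> \<in> space M. Y \<omega> = u} \<omega>))"
      by (intro Bochner_Integration.integral_sum integrable_mult_right) (simp add: less_top[symmetric])
    also have "\<dots> = (\<Sum>u\<in>B. pmf_at M Y u * f u)"
      by (simp add: pmf_at_def mult.commute)
    finally show ?thesis .
  qed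
  have "measure M {\<omega> \<in> space M. Y \<omega> \<in> S} = 1 \<longleftrightarrow> (AE \<omega> in M. Y \<omega> \<in> S)"
    using prob_Collect_eq_1[of "\<lambda>\<omega>. Y \<omega> \<in> S"] by simp
  also have "\<dots> \<longleftrightarrow> (\<forall>u. pmf_at M Y u > 0 \<longrightarrow> u \<in> S)"
  proof
    assume S: "AE \<omega> in M. Y \<omega> \<in> S"
    show "\<forall>u. pmf_at M Y u > 0 \<longrightarrow> u \<in> S"
    proof (intro allI impI, rule ccontr)
      fix u assume "pmf_at M Y u > 0" "u \<notin> S"
      moreover from S have "AE \<omega> in M. Y \<omega> \<noteq> u"
        by eventually_elim (use \<open>u \<notin> S\<close> in auto)
      ultimately show False by (simp add: null)
    qed
  next
    assume "\<forall>u. pmf_at M Y u > 0 \<longrightarrow> u \<in> S"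
    with pos show "AE \<omega> in M. Y \<omega> \<in> S" by auto
  qed
  finally show "measure M {\<omega> \<in> space M. Y \<omega> \<in> S} = 1 \<longleftrightarrow> (\<forall>u. pmf_at M Y u > 0 \<longrightarrow> u \<in> S)" .
qed

text \<open>
  By Bezout's identity, the multiples of \<open>h\<close> among the integers are closed under greatest common
  divisors, even if \<open>h\<close> is an arbitrary real number.
\<close>

lemma Gcd_in_lattice:
  fixes A :: "int set"
  assumes "finite A" "\<And>u. u \<in> A \<Longrightarrow> real_of_int u \<in> shifted_lattice 0 h"
  shows "real_of_int (Gcd A) \<in> shifted_lattice 0 h"
  using assms
proof (induction rule: finite_induct)
  case empty
  then show ?case by (auto simp: shifted_lattice_def)
next
  case (insert x A)
  have "real_of_int x \<in> shifted_lattice 0 h" "real_of_int (Gcd A) \<in> shifted_lattice 0 h"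
    using insert by auto
  then obtain i j :: int where ij: "real_of_int x = h * i" "real_of_int (Gcd A) = h * j"
    by (auto simp: shifted_lattice_def)
  obtain a b :: int where "a * x + b * Gcd A = gcd x (Gcd A)"
    using bezout_int by blast
  then have "real_of_int (Gcd (insert x A)) = a * real_of_int x + b * real_of_int (Gcd A)"
    by (metis Gcd_insert of_int_add of_int_mult)
  also have "\<dots> = 0 + h * of_int (a * i + b * j)" by (simp add: ij algebra_simps)
  finally show ?case unfolding shifted_lattice_def by blast
qed

text \<open>
  Every point of the lattice \<open>h \<int>\<close> has to be an integer, as otherwise the event that the colour equals
  this point would be empty while the Gaussian density does not vanish there.
\<close>

lemma maximal_step_eq_Gcd:
  fixes A :: "int set" and h :: real
  assumes A: "finite A" "u0 \<in> A" "u0 \<noteq> 0" and h: "h > 0"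
    and lattice: "\<And>u. u \<in> A \<Longrightarrow> real_of_int u \<in> shifted_lattice 0 h"
    and maximal: "\<And>d. d > 0 \<Longrightarrow> (\<And>u. u \<in> A \<Longrightarrow> real_of_int u \<in> shifted_lattice 0 d) \<Longrightarrow> d \<le> h"
  shows "h = real_of_int (Gcd A)"
proof -
  have "Gcd A \<noteq> 0" using A by (auto simp: Gcd_0_iff)
  then have g: "Gcd A > 0" by (metis Gcd_int_greater_eq_0 order_le_less)
  have "real_of_int (Gcd A) \<le> h"
  proof (rule maximal)
    fix u assume "u \<in> A"
    then obtain k where "u = Gcd A * k" using Gcd_dvd by blast
    then have "real_of_int u = 0 + real_of_int (Gcd A) * real_of_int k" by (metis add_0 of_int_mult)
    then show "real_of_int u \<in> shifted_lattice 0 (real_of_int (Gcd A))" unfolding shifted_lattice_def by blast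
  qed (use g in simp)
  moreover obtain k :: int where k: "real_of_int (Gcd A) = h * k"
    using Gcd_in_lattice[OF A(1) lattice] by (auto simp: shifted_lattice_def)
  have "k > 0" using g h k by (metis of_int_0_less_iff zero_less_mult_pos)
  then have "h * 1 \<le> real_of_int (Gcd A)" unfolding k using h by (intro mult_left_mono) auto
  ultimately show ?thesis by simp
qed

section \<open>The local limit theorem on the lattice of the span\<close>

theorem theorem5:
  fixes N :: "'a measure" and X :: "nat \<Rightarrow> 'a \<Rightarrow> int" and B :: "int set"
    and p :: "int \<Rightarrow> real" and \<mu> \<sigma> a h :: real
    and M :: "'w measure" and U0 :: "int \<Rightarrow> real"
    and U :: "nat \<Rightarrow> 'w \<Rightarrow> int \<Rightarrow> real" and Z :: "nat \<Rightarrow> 'w \<Rightarrow> int"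
  assumes walk: "prob_space N" "iid_int N X"
    and p_def: "p = pmf_at N (X 1)"
    and bounded: "finite B" "B \<noteq> {}" "\<And>u. u \<notin> B \<Longrightarrow> p u = 0"
    and mean: "\<mu> = prob_space.expectation N (\<lambda>\<omega>. real_of_int (X 1 \<omega>))"
    and second_moment: "\<sigma>\<^sup>2 = prob_space.expectation N (\<lambda>\<omega>. (real_of_int (X 1 \<omega>))\<^sup>2)"
    and sigma_pos: "\<sigma> > 0"
    and urn: "initial_configuration U0" "infinite_color_urn M p U0 U Z"
    and span: "is_span N (X 1) h"
      "measure N {\<omega> \<in> space N. real_of_int (X 1 \<omega>) \<in> shifted_lattice a h} = 1"
    and start: "\<And>v. U0 v \<noteq> 0 \<Longrightarrow> real_of_int v \<in> shifted_lattice 0 h"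
    and lazy: "measure N {\<omega> \<in> space N. X 1 \<omega> = 0} > 0"
  shows "(\<lambda>n. SUP x \<in> urn_lattice a h \<mu> \<sigma> n.
            \<bar>\<sigma> * sqrt (ln (real n)) / h *
               measure M {\<omega> \<in> space M.
                 (real_of_int (Z n \<omega>) - \<mu> * ln (real n)) / (\<sigma> * sqrt (ln (real n))) = x}
             - std_normal_density x\<bar>) \<longlonglongrightarrow> 0"
proof -
  interpret N: prob_space N by (rule walk(1))
  interpret M: prob_space M using urn(2) by (simp add: infinite_color_urn_def)
  define supp where "supp = {u \<in> B. p u > 0}"
  define T where "T = {v. U0 v \<noteq> 0}"
  define q where "q n v = measure M {\<omega> \<in> space M. Z n \<omega> = v}" for n v
  define c where "c n = \<sigma> * sqrt (ln (real n))" for n :: nat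
  have X1: "X 1 \<in> measurable N (count_space UNIV)"
    using walk(2) unfolding iid_int_def N.indep_vars_def by auto
  have B: "finite B" "\<And>u. u \<notin> B \<Longrightarrow> pmf_at N (X 1) u = 0"
    using bounded by (auto simp: p_def)
  note law = N.finite_support_law[OF X1 B, folded p_def]
  have p_nonneg: "p u \<ge> 0" for u by (simp add: p_def pmf_at_def)
  have p_sum: "sum p B = 1"
    using law(1)[of "\<lambda>_. 1"] N.prob_space by simp
  have mean': "\<mu> = (\<Sum>u\<in>B. p u * u)"
    unfolding mean by (rule law(1))
  have second': "\<sigma>\<^sup>2 = (\<Sum>u\<in>B. p u * (real_of_int u)\<^sup>2)"
    unfolding second_moment by (rule law(1))
  have h: "h > 0" using span(1) by (simp add: is_span_def)
  have in_lattice: "measure N {\<omega> \<in> space N. real_of_int (X 1 \<omega>) \<in> shifted_lattice b d} = 1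
      \<longleftrightarrow> (\<forall>u\<in>supp. real_of_int u \<in> shifted_lattice b d)" for b d
    using law(2)[of "{u. real_of_int u \<in> shifted_lattice b d}"] bounded(3)
    by (force simp: supp_def)
  have a_supp: "real_of_int u \<in> shifted_lattice a h" if "u \<in> supp" for u
    using span(2) that unfolding in_lattice by blast
  have "p 0 > 0" using lazy by (simp add: p_def pmf_at_def)
  then have "0 \<in> supp" using bounded(3) by (force simp: supp_def)
  \<comment> \<open>Since 0 is charged, a is a multiple of h, and all the shifts n * a disappear.\<close>
  then obtain z0 :: int where z0: "0 = a + h * z0"
    using a_supp[of 0] by (auto simp: shifted_lattice_def)
  have supp_lattice: "real_of_int u \<in> shifted_lattice 0 h" if u: "u \<in> supp" for u
  proof -
    obtain z :: int where "real_of_int u = a + h * z"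
      using a_supp[OF u] by (auto simp: shifted_lattice_def)
    then have "real_of_int u = 0 + h * of_int (z - z0)" using z0 by (simp add: algebra_simps)
    then show ?thesis unfolding shifted_lattice_def by blast
  qed
  have maximal: "d \<le> h" if "d > 0" "\<And>u. u \<in> supp \<Longrightarrow> real_of_int u \<in> shifted_lattice 0 d" for d
    using span(1) that in_lattice[of 0 d] unfolding is_span_def by blast
  obtain u0 where u0: "u0 \<in> supp" "u0 \<noteq> 0"
  proof -
    have "(\<Sum>u\<in>B. p u * (real_of_int u)\<^sup>2) \<noteq> 0"
      using sigma_pos by (simp flip: second')
    then obtain u where "u \<in> B" "p u * (real_of_int u)\<^sup>2 \<noteq> 0"
      by (rule sum.not_neutral_contains_not_neutral)
    then show thesis using that[of u] p_nonneg[of u] by (simp add: supp_def)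
  qed
  have h_int: "h = real_of_int (Gcd supp)"
    using bounded(1) by (intro maximal_step_eq_Gcd[OF _ u0 h supp_lattice maximal]) (auto simp: supp_def)
  have T: "finite T" "\<And>v. U0 v \<ge> 0" "sum U0 T = 1"
    using urn(1) by (auto simp: T_def initial_configuration_def)
  have q0: "q 0 = U0"
    unfolding q_def using urn_colour_law(1)[OF bounded(1,3) urn(2)] by (intro ext) simp
  have step: "real (Suc (Suc n)) * q (Suc n) v = real (Suc n) * q n v + (\<Sum>u\<in>B. p u * q n (v - u))" for n v
    unfolding q_def by (rule urn_colour_law(2)[OF bounded(1,3) urn(2)])
  obtain \<epsilon> where \<epsilon>: "\<epsilon> \<longlonglongrightarrow> 0"
    "\<And>n v. n \<ge> 2 \<Longrightarrow> real_of_int v \<in> shifted_lattice 0 h \<Longrightarrow>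
      \<bar>c n / h * q n v - std_normal_density ((v - \<mu> * ln (real n)) / c n)\<bar> \<le> \<epsilon> n"
    unfolding c_def
  proof (rule urn_local_limit[of T q h B p \<mu> \<sigma>])
    show "real_of_int u \<in> shifted_lattice 0 h" if "u \<in> B" "p u \<noteq> 0" for u
      using that p_nonneg[of u] by (intro supp_lattice) (simp add: supp_def)
    show "d \<le> h" if "d > 0" "\<And>u. u \<in> B \<Longrightarrow> p u > 0 \<Longrightarrow> real_of_int u \<in> shifted_lattice 0 d" for d
      using that by (intro maximal) (auto simp: supp_def)
  qed (use T start bounded(1) p_nonneg p_sum step mean' second' sigma_pos h in \<open>auto simp: q0 T_def\<close>)
  have term_le: "\<bar>c n / h * measure M {\<omega> \<in> space M. (real_of_int (Z n \<omega>) - \<mu> * ln (real n)) / c n = x}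
      - std_normal_density x\<bar> \<le> \<epsilon> n" if n: "n \<ge> 2" and x: "x \<in> urn_lattice a h \<mu> \<sigma> n" for n x
  proof -
    have L: "ln (real n) > 0" and c: "c n > 0" using n sigma_pos by (simp_all add: c_def)
    obtain z :: int where z: "x = real n / c n * a - \<mu> / \<sigma> * sqrt (ln (real n)) + h / c n * z"
      using x by (auto simp: urn_lattice_def c_def)
    \<comment> \<open>The colour that corresponds to x: the shift n * a equals - n * h * z0.\<close>
    define v where "v = Gcd supp * (z - int n * z0)"
    have v: "real_of_int v = 0 + h * of_int (z - int n * z0)" by (simp add: v_def h_int)
    have "\<mu> / \<sigma> * sqrt (ln (real n)) = \<mu> * ln (real n) / c n"
      using L sigma_pos by (simp add: c_def divide_simps)
    moreover have "a = - (h * z0)" using z0 by simp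
    ultimately have xv: "x = (real_of_int v - \<mu> * ln (real n)) / c n"
      unfolding z v by (simp add: add_divide_distrib diff_divide_distrib algebra_simps)
    have "{\<omega> \<in> space M. (real_of_int (Z n \<omega>) - \<mu> * ln (real n)) / c n = x} = {\<omega> \<in> space M. Z n \<omega> = v}"
      using c by (auto simp: xv)
    moreover have "real_of_int v \<in> shifted_lattice 0 h"
      unfolding shifted_lattice_def using v by blast
    ultimately show ?thesis using \<epsilon>(2)[OF n, of v] by (simp add: q_def xv)
  qed
  define S where "S n = (SUP x \<in> urn_lattice a h \<mu> \<sigma> n.
      \<bar>c n / h * measure M {\<omega> \<in> space M. (real_of_int (Z n \<omega>) - \<mu> * ln (real n)) / c n = x}
        - std_normal_density x\<bar>)" for n
  have S_bounds: "0 \<le> S n" "S n \<le> \<epsilon> n" if n: "n \<ge> 2" for n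
  proof -
    obtain x0 where x0: "x0 \<in> urn_lattice a h \<mu> \<sigma> n" by (auto simp: urn_lattice_def)
    then show "S n \<le> \<epsilon> n"
      unfolding S_def by (intro cSUP_least term_le[OF n]) auto
    have "0 \<le> \<bar>c n / h * measure M {\<omega> \<in> space M. (real_of_int (Z n \<omega>) - \<mu> * ln (real n)) / c n = x0}
        - std_normal_density x0\<bar>" by simp
    also have "\<dots> \<le> S n"
      unfolding S_def by (intro cSUP_upper x0 bdd_aboveI2[OF term_le[OF n]])
    finally show "0 \<le> S n" .
  qed
  have "S \<longlonglongrightarrow> 0"
  proof (rule tendsto_sandwich[OF _ _ tendsto_const \<epsilon>(1)])
    show "\<forall>\<^sub>F n in sequentially. 0 \<le> S n" "\<forall>\<^sub>F n in sequentially. S n \<le> \<epsilon> n"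
      using eventually_ge_at_top[of "2::nat"] by (eventually_elim, simp add: S_bounds)+
  qed
  then show ?thesis by (simp add: S_def[abs_def] c_def)
qed

end
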